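(* Let $\mathcal{B}$ be the family of all rank-labeled binary trees on $[T]$, and for $B\in\mathcal{B}$ and $t\in[T]$ let $l^B(t)$ and $r^B(t)$ be the numbers of nodes in the left and right subtree of $t$ in $B$. Then $$\operatorname{epi}(\mathrm{LCU}^\Sigma)=\Big\{(v,c)\in\mathbb{R}^{T}\times\mathbb{R}\ :\ c\ge\sum_{t\in[T]}\delta^t\big(l^B(t),r^B(t)\big)\,v^t\ \text{ for all } B\in\mathcal{B},\quad 0\le v^t\le 1\ \text{ for all } t\in[T]\Big\}.$$
   Context: Fix an integer $T\ge 1$, $[T]=\{1,\dots,T\}$ (periods), period lengths $L^1,\dots,L^T>0$, a pre-model offline time $\mathrm{PDT}\ge 0$, and a start-up cost function $\mathrm{CU}:[0,\infty)\to[0,\infty)$ that is (weakly) increasing, concave, and satisfies $\mathrm{CU}(0)=0$. For $t\in[T]$ and $l\in\{0,\dots,t-1\}$ let $\mathrm{OL}^t(l)=\sum_{j=1}^{l}L^{t-j}$ if $l<t-1$, and $\mathrm{OL}^t(l)=\sum_{j=1}^{l}L^{t-j}+\mathrm{PDT}$ if $l=t-1$; let $\mathrm{CU}^t(l)=\mathrm{CU}(\mathrm{OL}^t(l))$. For $v=(v^1,\dots,v^T)\in\{0,1\}^T$ let $\mathrm{ol}^t(v)=\max\{l\in\{0,\dots,t-1\}: v^{t-1}=\dots=v^{t-l}=0\}$, $\mathrm{DCU}^t(v)=\mathrm{CU}^t(\mathrm{ol}^t(v))$ if $v^t=1$ and $\mathrm{DCU}^t(v)=0$ otherwise, and $\mathrm{DCU}^\Sigma(v)=\sum_{t=1}^T\mathrm{DCU}^t(v)$.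 Let $\operatorname{epi}(\mathrm{DCU}^\Sigma)=\{(v,c): v\in\{0,1\}^T,\ c\ge \mathrm{DCU}^\Sigma(v)\}$, and let $\mathrm{LCU}^\Sigma:[0,1]^T\to\mathbb{R}$ be the unique function whose epigraph $\operatorname{epi}(\mathrm{LCU}^\Sigma)=\{(v,c):v\in[0,1]^T,\ c\ge\mathrm{LCU}^\Sigma(v)\}$ equals $\operatorname{conv}(\operatorname{epi}(\mathrm{DCU}^\Sigma))$. For $t\in[T]$ define $\delta^t:\{0,\dots,t-1\}\times\{0,\dots,T-t\}\to\mathbb{R}$ by $\delta^t(l,r)=\mathrm{CU}^t(l)+\mathrm{CU}^{t+r+1}(r)-\mathrm{CU}^{t+r+1}(l+r+1)$ if $t+r<T$, and $\delta^t(l,r)=\mathrm{CU}^t(l)$ if $t+r=T$. A binary tree is a rooted tree in which every node has at most one left child and at most one right child. It is a rank-labeled binary tree on $[T]$ if its node set is $[T]$ and the in-order (left-to-right) position of each node $t$ is $t$; i.e. all nodes in the left subtree of $t$ are smaller than $t$ and all nodes in the right subtree of $t$ are larger than $t$. *)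

theory Defs
  imports "HOL-Analysis.Analysis" "HOL-Library.Tree"
begin

text \<open>
  The periods are the naturals \<open>1, \<dots>, T\<close>. Vectors of \<open>\<real>\<^sup>T\<close> are elements of \<^typ>\<open>real ^ 'n\<close>,
  where \<open>'n\<close> is any finite type that is enumerated by a bijection \<open>per\<close> from
  \<^term>\<open>{1..T}\<close> to \<open>UNIV :: 'n set\<close>; the component of \<open>v\<close> at period \<open>t\<close> is \<open>v $ per t\<close>.
\<close>

definition OL :: "(nat \<Rightarrow> real) \<Rightarrow> real \<Rightarrow> nat \<Rightarrow> nat \<Rightarrow> real" where
  "OL L PDT t l =
     (if l < t - 1 then (\<Sum>j=1..l. L (t - j)) else (\<Sum>j=1..l. L (t - j)) + PDT)"

definition CUt :: "(nat \<Rightarrow> real) \<Rightarrow> real \<Rightarrow> (real \<Rightarrow> real) \<Rightarrow> nat \<Rightarrow> nat \<Rightarrow> real" where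
  "CUt L PDT CU t l = CU (OL L PDT t l)"

definition ol :: "(nat \<Rightarrow> 'n) \<Rightarrow> nat \<Rightarrow> real ^ 'n \<Rightarrow> nat" where
  "ol per t v = Max {l \<in> {0..t-1}. \<forall>j\<in>{1..l}. v $ per (t - j) = 0}"

definition DCUt ::
  "(nat \<Rightarrow> real) \<Rightarrow> real \<Rightarrow> (real \<Rightarrow> real) \<Rightarrow> (nat \<Rightarrow> 'n) \<Rightarrow> nat \<Rightarrow> real ^ 'n \<Rightarrow> real" where
  "DCUt L PDT CU per t v = (if v $ per t = 1 then CUt L PDT CU t (ol per t v) else 0)"

definition DCU ::
  "nat \<Rightarrow> (nat \<Rightarrow> real) \<Rightarrow> real \<Rightarrow> (real \<Rightarrow> real) \<Rightarrow> (nat \<Rightarrow> 'n) \<Rightarrow> real ^ 'n \<Rightarrow> real" where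
  "DCU T L PDT CU per v = (\<Sum>t=1..T. DCUt L PDT CU per t v)"

definition binary_cube :: "(real ^ 'n) set" where
  "binary_cube = {v. \<forall>i. v $ i \<in> {0, 1}}"

definition unit_cube :: "(real ^ 'n) set" where
  "unit_cube = {v. \<forall>i. 0 \<le> v $ i \<and> v $ i \<le> 1}"

text \<open>
  The unique function on the unit cube whose epigraph is the convex hull of the epigraph
  of \<open>DCU\<close>. Since HOL functions are total, uniqueness requires fixing
  the values outside the cube, which is done by \<^const>\<open>extensional\<close>; these values do not
  enter the epigraph over the cube. Existence and uniqueness are shown in \<open>LCU_ex1\<close> below.
\<close>

definition LCU ::
  "nat \<Rightarrow> (nat \<Rightarrow> real) \<Rightarrow> real \<Rightarrow> (real \<Rightarrow> real) \<Rightarrow> (nat \<Rightarrow> 'n::finite) \<Rightarrow> real ^ 'n \<Rightarrow> real" where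
  "LCU T L PDT CU per =
     (THE f. f \<in> extensional unit_cube \<and>
        epigraph unit_cube f = convex hull (epigraph binary_cube (DCU T L PDT CU per)))"

definition \<delta> ::
  "nat \<Rightarrow> (nat \<Rightarrow> real) \<Rightarrow> real \<Rightarrow> (real \<Rightarrow> real) \<Rightarrow> nat \<Rightarrow> nat \<Rightarrow> nat \<Rightarrow> real" where
  "\<delta> T L PDT CU t l r =
     (if t + r < T
      then CUt L PDT CU t l + CUt L PDT CU (t + r + 1) r - CUt L PDT CU (t + r + 1) (l + r + 1)
      else CUt L PDT CU t l)"

definition rank_labeled_trees :: "nat \<Rightarrow> nat tree set" where
  "rank_labeled_trees T = {B. inorder B = [1..<T+1]}"

text \<open>The subtree rooted at the node labeled \<open>x\<close>, for trees with pairwise distinct labels.\<close>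

fun subtree_at :: "'a tree \<Rightarrow> 'a \<Rightarrow> 'a tree" where
  "subtree_at Leaf x = Leaf"
| "subtree_at (Node l a r) x =
     (if x = a then Node l a r
      else if x \<in> set_tree l then subtree_at l x
      else subtree_at r x)"

definition left_count :: "'a tree \<Rightarrow> 'a \<Rightarrow> nat" where
  "left_count B x = size (left (subtree_at B x))"

definition right_count :: "'a tree \<Rightarrow> 'a \<Rightarrow> nat" where
  "right_count B x = size (right (subtree_at B x))"

lemma unit_cube_eq_hull: "(unit_cube :: (real ^ 'n) set) = convex hull binary_cube"
proof -
  have "(unit_cube :: (real ^ 'n) set) = cbox 0 1"
    by (auto simp: unit_cube_def mem_box_cart)
  then show ?thesis
    using unit_interval_convex_hull[where 'a = "real ^ 'n"]
    by (simp add: binary_cube_def Basis_vec_def inner_axis Cart_1 )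
qed

lemma finite_binary_cube: "finite (binary_cube :: (real ^ 'n) set)"
proof -
  have "(binary_cube :: (real ^ 'n) set) \<subseteq> (\<lambda>A. \<chi> i. if i \<in> A then 1 else 0) ` UNIV"
  proof
    fix v :: "real ^ 'n" assume "v \<in> binary_cube"
    then have "v = (\<chi> i. if i \<in> {i. v $ i = 1} then 1 else 0)"
      by (auto simp: binary_cube_def vec_eq_iff)
    then show "v \<in> (\<lambda>A. \<chi> i. if i \<in> A then 1 else 0) ` UNIV" by blast
  qed
  then show ?thesis by (rule finite_subset) simp
qed

lemma LCU_ex1:
  fixes D :: "real ^ 'n \<Rightarrow> real"
  shows "\<exists>!f. f \<in> extensional unit_cube \<and>
           epigraph unit_cube f = convex hull (epigraph binary_cube D)"
proof -
  define H where "H = convex hull (epigraph binary_cube D)"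
  define P where "P = convex hull ((\<lambda>v. (v, D v)) ` binary_cube)"
  define R where "R = {0 :: real ^ 'n} \<times> {0::real..}"
  define m where "m = Min (D ` binary_cube)"
  have "epigraph binary_cube D = (\<Union>x\<in>(\<lambda>v. (v, D v)) ` binary_cube. \<Union>y\<in>R. {x + y})"
  proof (intro set_eqI iffI)
    fix z assume z: "z \<in> epigraph binary_cube D"
    then have "z = (fst z, D (fst z)) + (0, snd z - D (fst z))" "fst z \<in> binary_cube"
      "(0, snd z - D (fst z)) \<in> R"
      by (auto simp: epigraph_def R_def prod_eq_iff)
    then show "z \<in> (\<Union>x\<in>(\<lambda>v. (v, D v)) ` binary_cube. \<Union>y\<in>R. {x + y})" by blast
  qed (auto simp: epigraph_def R_def)
  then have ep: "epigraph binary_cube D = {x + y |x y. x \<in> (\<lambda>v. (v, D v)) ` binary_cube \<and> y \<in> R}"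
    by blast
  have cR: "convex R" unfolding R_def by (intro convex_Times) auto
  have H_eq: "H = (\<Union>x\<in>P. \<Union>y\<in>R. {x + y})"
  proof
    have cv: "convex (\<Union>x\<in>P. \<Union>y\<in>R. {x + y})"
      by (intro convex_sums cR) (simp add: P_def)
    show "H \<subseteq> (\<Union>x\<in>P. \<Union>y\<in>R. {x + y})"
      unfolding H_def
    proof (intro hull_minimal cv)
      have "(\<lambda>v. (v, D v)) ` binary_cube \<subseteq> P" unfolding P_def by (rule hull_subset)
      then show "epigraph binary_cube D \<subseteq> (\<Union>x\<in>P. \<Union>y\<in>R. {x + y})"
        unfolding ep by blast
    qed
    show "(\<Union>x\<in>P. \<Union>y\<in>R. {x + y}) \<subseteq> H"
    proof
      fix z assume "z \<in> (\<Union>x\<in>P. \<Union>y\<in>R. {x + y})"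
      then obtain x y where x: "x \<in> P" and y: "y \<in> R" and "z = x + y"
        by blast
      then have z: "z = y + x" by (simp only: add.commute)
      have "(\<lambda>x. y + x) ` P = convex hull ((\<lambda>x. y + x) ` ((\<lambda>v. (v, D v)) ` binary_cube))"
        unfolding P_def by (simp only: convex_hull_translation)
      also have "\<dots> \<subseteq> H"
        unfolding H_def using y by (intro hull_mono) (auto simp: epigraph_def R_def)
      finally show "z \<in> H" using x z by blast
    qed
  qed
  have "compact P" unfolding P_def
    by (intro finite_imp_compact_convex_hull finite_imageI finite_binary_cube)
  moreover have "closed R" unfolding R_def by (intro closed_Times) auto
  ultimately have clH: "closed H" unfolding H_eq by (rule compact_closed_sums)
  have up: "(v, c') \<in> H" if "(v, c) \<in> H" "c \<le> c'" for v c c'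
  proof -
    from that(1) obtain x y where xy: "x \<in> P" "y \<in> R" "(v, c) = x + y" unfolding H_eq by blast
    have "y + (0, c' - c) \<in> R" using xy(2) that(2) by (auto simp: R_def)
    moreover have "(v, c') = x + (y + (0, c' - c))"
      using xy(3) by (auto simp: prod_eq_iff)
    ultimately show ?thesis using xy(1) unfolding H_eq by blast
  qed
  have "H \<subseteq> UNIV \<times> {m..}" unfolding H_def
  proof (rule hull_minimal)
    show "epigraph binary_cube D \<subseteq> UNIV \<times> {m..}"
    proof
      fix z assume "z \<in> epigraph binary_cube D"
      then have "fst z \<in> binary_cube" "D (fst z) \<le> snd z" by (auto simp: epigraph_def)
      moreover from this have "m \<le> D (fst z)"
        unfolding m_def by (intro Min_le) (auto simp: finite_binary_cube)
      ultimately show "z \<in> UNIV \<times> {m..}" by (cases z) auto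
    qed
  qed (intro convex_Times; auto)
  then have low: "m \<le> c" if "(v, c) \<in> H" for v c using that by auto
  have "fst ` H = convex hull (fst ` epigraph binary_cube D)"
    unfolding H_def by (intro convex_hull_linear_image linear_fst)
  also have "fst ` epigraph binary_cube D = binary_cube"
    by (force simp: epigraph_def image_iff)
  finally have fstH: "fst ` H = unit_cube" by (simp add: unit_cube_eq_hull)
  define f where "f = restrict (\<lambda>v. Inf {c. (v, c) \<in> H}) unit_cube"
  have f_iff: "(v, c) \<in> H \<longleftrightarrow> f v \<le> c" if v: "v \<in> unit_cube" for v c
  proof -
    let ?S = "{c. (v, c) \<in> H}"
    have ne: "?S \<noteq> {}" using v unfolding fstH[symmetric] by force
    have bd: "bdd_below ?S" using low by (intro bdd_belowI[of _ m]) auto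
    have "closed (Pair v -` H)"
      by (rule closed_vimage[OF clH]) (intro continuous_intros)
    then have cl: "closed ?S" by (simp add: vimage_def)
    have mem: "Inf ?S \<in> ?S" by (rule closed_contains_Inf[OF ne bd cl])
    show ?thesis
    proof
      assume "(v, c) \<in> H"
      then show "f v \<le> c" using v bd by (auto simp: f_def intro: cInf_lower)
    next
      assume "f v \<le> c"
      then show "(v, c) \<in> H" using up[of v "Inf ?S" c] mem v by (simp add: f_def)
    qed
  qed
  have ep_f: "epigraph unit_cube f = H"
    using f_iff fstH by (force simp: epigraph_def)
  have ext_f: "f \<in> extensional unit_cube" by (simp add: f_def)
  show ?thesis unfolding H_def[symmetric]
  proof (rule ex1I)
    show "f \<in> extensional unit_cube \<and> epigraph unit_cube f = H"
      using ext_f ep_f by (rule conjI)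
  next
    fix g :: "real ^ 'n \<Rightarrow> real"
    assume g: "g \<in> extensional unit_cube \<and> epigraph unit_cube g = H"
    show "g = f"
    proof (rule extensionalityI[OF conjunct1[OF g] ext_f])
      fix v :: "real ^ 'n" assume v: "v \<in> unit_cube"
      have "g v \<le> c \<longleftrightarrow> f v \<le> c" for c
        using conjunct2[OF g] f_iff[OF v, of c] v mem_epigraph[of v c unit_cube g] by simp
      then show "g v = f v" by (meson order_antisym order_refl)
    qed
  qed
qed

end

theory Submission
  imports Defs
begin

text \<open>
  The cost of a binary vector is the length of the path \<open>0 \<rightarrow> t\<^sub>1 \<rightarrow> \<dots> \<rightarrow> t\<^sub>k \<rightarrow> T + 1\<close> through its
  on-periods, where an arc \<open>(a, t)\<close> costs a start at \<open>t\<close> after being off since \<open>a\<close>, and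
  \<open>\<delta>\<^sup>t(l, r)\<close> is the cost of inserting \<open>t\<close> into the arc from \<open>t - l - 1\<close> to \<open>t + r + 1\<close>.
  Concavity and monotonicity of the start-up cost make this insertion cost increase with the
  arc (submodularity), so, by induction on the tree, every tree inequality is valid on binary vectors.
  Conversely, the Cartesian tree of \<open>v\<close> inserts the periods in order of decreasing \<open>v\<close>, so its
  inequality is tight on every threshold vector \<open>1[v \<ge> \<theta>]\<close>; and \<open>v\<close> is a convex combination of
  its threshold vectors.
\<close>

section \<open>Sums over the nodes of a tree\<close>

primrec tree_sum :: "('a \<Rightarrow> nat \<Rightarrow> nat \<Rightarrow> real) \<Rightarrow> 'a tree \<Rightarrow> real" where
  "tree_sum f Leaf = 0"
| "tree_sum f (Node l a r) = f a (size l) (size r) + tree_sum f l + tree_sum f r"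

text \<open>As labels are distinct, looking up a label of a child in the whole tree or in that child
  finds the same subtree. The sum over labels therefore unfolds along the tree, which opens it to
  induction.\<close>

lemma sum_counts_eq_tree_sum:
  assumes "distinct (inorder B)"
  shows "(\<Sum>x\<in>set_tree B. f x (left_count B x) (right_count B x)) = tree_sum f B"
  using assms
proof (induction B)
  case (Node l a r)
  let ?g = "\<lambda>B x. f x (left_count B x) (right_count B x)"
  let ?B = "Node l a r"
  have d: "set_tree l \<inter> set_tree r = {}" "a \<notin> set_tree l" "a \<notin> set_tree r"
    using Node.prems by auto
  have "(\<Sum>x\<in>set_tree ?B. ?g ?B x) =
      ?g ?B a + ((\<Sum>x\<in>set_tree l. ?g ?B x) + (\<Sum>x\<in>set_tree r. ?g ?B x))"
    using d by (simp add: sum.union_disjoint)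
  also have "(\<Sum>x\<in>set_tree l. ?g ?B x) = (\<Sum>x\<in>set_tree l. ?g l x)"
    using d by (intro sum.cong) (auto simp: left_count_def right_count_def)
  also have "(\<Sum>x\<in>set_tree r. ?g ?B x) = (\<Sum>x\<in>set_tree r. ?g r x)"
    using d by (intro sum.cong) (auto simp: left_count_def right_count_def)
  finally show ?case
    using Node by (simp add: left_count_def right_count_def)
qed simp

section \<open>Paths through the on-periods\<close>

fun path_sum :: "('a \<Rightarrow> 'a \<Rightarrow> real) \<Rightarrow> 'a list \<Rightarrow> real" where
  "path_sum K (x # y # zs) = K x y + path_sum K (y # zs)"
| "path_sum K _ = 0"

lemma path_sum_append:
  "path_sum K (xs @ y # zs) = path_sum K (xs @ [y]) + path_sum K (y # zs)"
  by (induction K xs rule: path_sum.induct) auto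

lemma path_sum_snoc:
  "xs \<noteq> [] \<Longrightarrow> path_sum K (xs @ [y]) = path_sum K xs + K (last xs) y"
  by (induction K xs rule: path_sum.induct) auto

abbreviation on_path :: "(nat \<Rightarrow> bool) \<Rightarrow> nat \<Rightarrow> nat \<Rightarrow> nat list" where
  "on_path p a u \<equiv> a # filter p [Suc a..<u] @ [u]"

definition insertion_cost :: "(nat \<Rightarrow> nat \<Rightarrow> real) \<Rightarrow> nat \<Rightarrow> nat \<Rightarrow> nat \<Rightarrow> real" where
  "insertion_cost K t l r = K (t - Suc l) t + K t (t + Suc r) - K (t - Suc l) (t + Suc r)"

lemma filter_upt_split:
  assumes "a < t" "t < u"
  shows "filter p [Suc a..<u] =
    filter p [Suc a..<t] @ (if p t then [t] else []) @ filter p [Suc t..<u]"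
proof -
  have "[Suc a..<u] = [Suc a..<t] @ [t..<u]"
    using assms by (metis Suc_leI less_imp_le_nat le_add_diff_inverse upt_add_eq_append)
  also have "[t..<u] = t # [Suc t..<u]" using assms by (simp add: upt_conv_Cons)
  finally show ?thesis by simp
qed

lemma path_sum_on_path_split:
  assumes "a < t" "t < u" "p t"
  shows "path_sum K (on_path p a u) = path_sum K (on_path p a t) + path_sum K (on_path p t u)"
  using path_sum_append[of K "a # filter p [Suc a..<t]" t "filter p [Suc t..<u] @ [u]"] assms
  by (simp add: filter_upt_split[of a t u])

text \<open>Only one arc of the path from \<open>a\<close> to \<open>u\<close> jumps over the
  off-period \<open>t\<close>. Forcing the path through \<open>t\<close> changes that arc alone, and
  by \<open>K\<close> the extra cost there is at most that for the widest arc, from \<open>a\<close>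
  to \<open>u\<close>.\<close>

lemma path_sum_insert_le:
  assumes K: "\<And>s w. \<lbrakk>a \<le> s; s < t; t < w; w \<le> u\<rbrakk>
      \<Longrightarrow> K s t + K t w - K s w \<le> K a t + K t u - K a u"
    and "a < t" "t < u" "\<not> p t"
  shows "path_sum K (on_path p a t) + path_sum K (on_path p t u)
    \<le> path_sum K (on_path p a u) + (K a t + K t u - K a u)"
proof -
  let ?xs = "a # filter p [Suc a..<t]" and ?ys = "filter p [Suc t..<u] @ [u]"
  \<comment> \<open>The arc jumping over \<open>t\<close> runs from \<open>s\<close>, the last path
    node before \<open>t\<close>, to \<open>w\<close>, the first one after it.\<close>
  obtain xs s where xs: "?xs = xs @ [s]" by (metis list.distinct(1) rev_exhaust)
  obtain ys w where ys: "?ys = w # ys" by (cases ?ys) auto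
  have "s \<in> set ?xs" "w \<in> set ?ys" unfolding xs ys by auto
  then have sw: "a \<le> s" "s < t" "t < w" "w \<le> u" using assms by auto
  have "on_path p a t = ?xs @ [t]" by simp
  then have at: "on_path p a t = (xs @ [s]) @ [t]" unfolding xs .
  have "path_sum K (on_path p a t) = path_sum K (xs @ [s]) + K s t"
    unfolding at using path_sum_snoc[of "xs @ [s]" K t] by simp
  moreover have "path_sum K (on_path p t u) = K t w + path_sum K (w # ys)"
    using ys by simp
  moreover have "on_path p a u = ?xs @ ?ys"
    using assms by (simp add: filter_upt_split[of a t u])
  then have "on_path p a u = xs @ s # w # ys" unfolding xs ys by simp
  then have "path_sum K (on_path p a u) = path_sum K (xs @ [s]) + (K s w + path_sum K (w # ys))"
    using path_sum_append[of K xs s "w # ys"] by simp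
  ultimately show ?thesis using K[OF sw] by simp
qed

section \<open>Tree sums compared with path lengths\<close>

text \<open>The subtree sizes at the root recover the ends \<open>a\<close> and \<open>u\<close> of
  the enclosing interval. Hence \<open>insertion_cost\<close> at the root refers to the arc from
  \<open>a\<close> to \<open>u\<close>, and inductions over trees can carry these two ends
  along.\<close>

lemma inorder_upt_NodeD:
  assumes "inorder (Node l t r) = [Suc a..<u]"
  shows "a < t" "t < u" "inorder l = [Suc a..<t]" "inorder r = [Suc t..<u]"
    "t - Suc (size l) = a" "t + Suc (size r) = u" "size l < t"
proof -
  have e: "[Suc a..<u] = inorder l @ t # inorder r" using assms by simp
  then have "t \<in> set [Suc a..<u]" by simp
  then show t: "a < t" "t < u" by auto
  have e': "[Suc a..<u] = [Suc a..<t] @ t # [Suc t..<u]"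
    using filter_upt_split[OF t, of "\<lambda>_. True"] by simp
  have d: "distinct (inorder l @ t # inorder r)" unfolding e[symmetric] by simp
  have "inorder l = [Suc a..<t] \<and> inorder r = [Suc t..<u]"
    using e e' d by (subst (asm) e', subst (asm) append_Cons_eq_iff) auto
  then show io: "inorder l = [Suc a..<t]" "inorder r = [Suc t..<u]" by auto
  have "size l = t - Suc a" "size r = u - Suc t"
    by (simp_all add: length_inorder[symmetric] io)
  then show "t - Suc (size l) = a" "t + Suc (size r) = u" "size l < t" using t by auto
qed

text \<open>Induction on the tree, splitting at the root \<open>t\<close>. If \<open>t\<close> is
  on, the path splits there too and the insertion cost makes up the difference exactly. If
  \<open>t\<close> is off, the root contributes nothing, and the detour through \<open>t\<close>
  that the two subtrees assume is paid for by \<open>path_sum_insert_le\<close>.\<close>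

lemma tree_sum_le_path_sum:
  assumes K: "\<And>a s t w u. \<lbrakk>a \<le> s; s < t; t < w; w \<le> u; u \<le> N\<rbrakk>
      \<Longrightarrow> K s t + K t w - K s w \<le> K a t + K t u - K a u"
    and "\<And>t. x t \<in> {0, 1 :: real}"
    and "inorder B = [Suc a..<u]" "a < u" "u \<le> N"
  shows "tree_sum (\<lambda>t l r. insertion_cost K t l r * x t) B + K a u
    \<le> path_sum K (on_path (\<lambda>t. x t = 1) a u)"
  using assms(3-)
proof (induction B arbitrary: a u)
  case Leaf
  then have "u = Suc a"
    by (metis inorder.simps(1) upt_eq_Nil_conv Suc_leI le_antisym not_less_zero)
  then show ?case by simp
next
  case (Node l t r)
  note t = inorder_upt_NodeD[OF Node.prems(1)]
  have IH: "tree_sum (\<lambda>t l r. insertion_cost K t l r * x t) l + K a t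
      \<le> path_sum K (on_path (\<lambda>t. x t = 1) a t)"
    "tree_sum (\<lambda>t l r. insertion_cost K t l r * x t) r + K t u
      \<le> path_sum K (on_path (\<lambda>t. x t = 1) t u)"
    using Node.IH(1)[of a t] Node.IH(2)[of t u] t Node.prems by auto
  show ?case
  proof (cases "x t = 1")
    case True
    with IH path_sum_on_path_split[of a t u "\<lambda>t. x t = 1" K] t show ?thesis
      by (simp add: insertion_cost_def)
  next
    case False
    then have "x t = 0" using assms(2)[of t] by auto
    with IH path_sum_insert_le[of a t u K "\<lambda>t. x t = 1"] K t Node.prems show ?thesis
      by simp
  qed
qed

text \<open>The witness is the Cartesian tree of \<open>v\<close>, in which \<open>v\<close> decreases away from the root.\<close>

lemma exists_tree_sum_eq_path_sum:
  fixes v :: "nat \<Rightarrow> real"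
  assumes "a < u"
  shows "\<exists>B. inorder B = [Suc a..<u] \<and> (\<forall>\<theta>.
    tree_sum (\<lambda>t l r. insertion_cost K t l r * of_bool (\<theta> \<le> v t)) B + K a u
      = path_sum K (on_path (\<lambda>t. \<theta> \<le> v t) a u))"
  using assms
proof (induction "u - a" arbitrary: a u rule: less_induct)
  case less
  show ?case
  proof (cases "Suc a = u")
    case True
    then show ?thesis by (intro exI[of _ Leaf]) simp
  next
    case False
    then have ne: "{a<..<u} \<noteq> {}" using less.prems
      by (metis Suc_lessI empty_iff greaterThanLessThan_iff lessI)
    then have "Max (v ` {a<..<u}) \<in> v ` {a<..<u}" by (intro Max_in) auto
    then obtain t where t: "a < t" "t < u" and "v t = Max (v ` {a<..<u})" by auto
    then have mx: "v s \<le> v t" if "a < s" "s < u" for s using that by simp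
    have sm: "t - a < u - a" "u - t < u - a" using t by linarith+
    from less.hyps[OF sm(1)] t obtain l where l: "inorder l = [Suc a..<t]"
      and ls: "\<And>\<theta>. tree_sum (\<lambda>t l r. insertion_cost K t l r * of_bool (\<theta> \<le> v t)) l + K a t
        = path_sum K (on_path (\<lambda>t. \<theta> \<le> v t) a t)" by auto
    from less.hyps[OF sm(2)] t obtain r where r: "inorder r = [Suc t..<u]"
      and rs: "\<And>\<theta>. tree_sum (\<lambda>t l r. insertion_cost K t l r * of_bool (\<theta> \<le> v t)) r + K t u
        = path_sum K (on_path (\<lambda>t. \<theta> \<le> v t) t u)" by auto
    have io: "inorder (Node l t r) = [Suc a..<u]"
      using filter_upt_split[OF t, of "\<lambda>_. True"] l r by simp
    note sz = inorder_upt_NodeD(5,6)[OF io]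
    have "tree_sum (\<lambda>t l r. insertion_cost K t l r * of_bool (\<theta> \<le> v t)) (Node l t r) + K a u
      = path_sum K (on_path (\<lambda>t. \<theta> \<le> v t) a u)" for \<theta>
    proof (cases "\<theta> \<le> v t")
      case True
      then show ?thesis
        using ls[of \<theta>] rs[of \<theta>] sz path_sum_on_path_split[OF t, of "\<lambda>t. \<theta> \<le> v t" K]
        by (simp add: insertion_cost_def)
    next
      case False
      \<comment> \<open>The threshold exceeds the maximum, so nothing in the interval is on: all
        three paths are single arcs, and by the induction hypotheses both subtree sums
        vanish.\<close>
      then have off: "\<not> \<theta> \<le> v s" if "a < s" "s < u" for s using mx[OF that] by linarith
      then have "filter (\<lambda>t. \<theta> \<le> v t) [Suc a..<t] = []"
        "filter (\<lambda>t. \<theta> \<le> v t) [Suc t..<u] = []" "filter (\<lambda>t. \<theta> \<le> v t) [Suc a..<u] = []"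
        using t by (auto simp: filter_empty_conv)
      then show ?thesis using ls[of \<theta>] rs[of \<theta>] False by simp
    qed
    with io show ?thesis by blast
  qed
qed

section \<open>Decomposition of a point of the cube into threshold vectors\<close>

text \<open>Induction on the number of fractional components. With \<open>m\<close> the smallest of
  them, the threshold vector at \<open>m\<close> is the indicator of the support of
  \<open>v\<close>. Splitting it off with weight \<open>m\<close> leaves a point of the cube with
  fewer fractional components.\<close>

lemma in_convex_hull_thresholds:
  fixes v :: "real ^ 'n"
  assumes "v \<in> unit_cube"
  shows "v \<in> convex hull (range (\<lambda>\<theta>. \<chi> i. of_bool (\<theta> \<le> v $ i)))"
  using assms
proof (induction "card {i. 0 < v $ i \<and> v $ i < 1}" arbitrary: v rule: less_induct)
  case less
  let ?thr = "\<lambda>(v :: real ^ 'n) \<theta>. (\<chi> i. of_bool (\<theta> \<le> v $ i)) :: real ^ 'n"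
  let ?frac = "\<lambda>v :: real ^ 'n. {i. 0 < v $ i \<and> v $ i < 1}"
  have v01: "0 \<le> v $ i" "v $ i \<le> 1" for i using less.prems by (auto simp: unit_cube_def)
  show ?case
  proof (cases "?frac v = {}")
    case True
    have "v $ i = of_bool (1 \<le> v $ i)" for i
      using True v01[of i] by (cases "v $ i = 0"; cases "v $ i = 1") (force simp: less_le)+
    then have "v = ?thr v 1" by (simp add: vec_eq_iff)
    then show ?thesis by (metis hull_inc rangeI)
  next
    case False
    define m where "m = Min (($) v ` ?frac v)"
    have "m \<in> ($) v ` ?frac v" unfolding m_def using False by (intro Min_in) auto
    then obtain k where k: "k \<in> ?frac v" "v $ k = m" by auto
    then have m: "0 < m" "m < 1" by auto
    have m_le: "m \<le> v $ i" if "v $ i \<noteq> 0" for i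
    proof (cases "v $ i < 1")
      case True
      then have "i \<in> ?frac v" using that v01[of i] by auto
      then show ?thesis unfolding m_def by simp
    qed (use m in auto)
    \<comment> \<open>The rescaled remainder: \<open>v\<close> equals
      \<open>(1 - m) *\<^sub>R w\<close> plus \<open>m\<close> times the indicator of its support.
      The component \<open>k\<close> where the minimum is attained drops to 0.\<close>
    define w :: "real ^ 'n" where "w = (\<chi> i. if v $ i = 0 then 0 else (v $ i - m) / (1 - m))"
    have w: "w \<in> unit_cube"
      using m m_le v01 by (auto simp: unit_cube_def w_def)
    have "?frac w \<subset> ?frac v"
    proof
      show "?frac w \<subseteq> ?frac v"
        using m m_le by (fastforce simp: w_def split: if_splits)
      have "k \<notin> ?frac w" using k m by (simp add: w_def)
      then show "?frac w \<noteq> ?frac v" using k by blast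
    qed
    then have "card (?frac w) < card (?frac v)" by (simp add: psubset_card_mono)
    then have "w \<in> convex hull (range (?thr w))" using w by (rule less.hyps)
    \<comment> \<open>On the support of \<open>v\<close>, \<open>w\<close> is an increasing affine
      image of \<open>v\<close>, so a positive threshold \<theta> for \<open>w\<close> corresponds
      to \<open>m + \<theta> * (1 - m)\<close> for \<open>v\<close>. Nonpositive thresholds give the
      all-ones vector for both.\<close>
    moreover have "range (?thr w) \<subseteq> range (?thr v)"
    proof
      fix x assume "x \<in> range (?thr w)"
      then obtain \<theta> where x: "x = ?thr w \<theta>" by auto
      show "x \<in> range (?thr v)"
      proof (cases "\<theta> \<le> 0")
        case True
        then have "x = ?thr v 0" using v01 w unfolding x
          by (auto simp: vec_eq_iff unit_cube_def intro: order_trans)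
        then show ?thesis by blast
      next
        case False
        have "\<theta> \<le> w $ i \<longleftrightarrow> m + \<theta> * (1 - m) \<le> v $ i" for i
        proof (cases "v $ i = 0")
          case True
          have "0 < \<theta> * (1 - m)" using False m by simp
          then show ?thesis using True False m by (simp add: w_def not_le add_pos_pos)
        next
          case False
          then show ?thesis using m by (simp add: w_def pos_le_divide_eq le_diff_eq add.commute)
        qed
        then have "x = ?thr v (m + \<theta> * (1 - m))" unfolding x by simp
        then show ?thesis by blast
      qed
    qed
    ultimately have "w \<in> convex hull (range (?thr v))" using hull_mono by blast
    moreover have "?thr v m \<in> convex hull (range (?thr v))" by (intro hull_inc) simp
    ultimately have "(1 - m) *\<^sub>R w + m *\<^sub>R ?thr v m \<in> convex hull (range (?thr v))"
      using m by (intro convexD[OF convex_convex_hull]) auto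
    also have "(1 - m) *\<^sub>R w + m *\<^sub>R ?thr v m = v"
      using m m_le by (auto simp: vec_eq_iff w_def)
    finally show ?thesis .
  qed
qed

section \<open>Concave start-up costs and submodularity\<close>

text \<open>Both \<open>x'\<close> and \<open>x + y\<close> lie between \<open>x\<close> and
  \<open>x' + y\<close>, with complementary weights \<open>e\<close> and \<open>1 - e\<close>.
  Adding the two concavity inequalities cancels the weights.\<close>

lemma concave_on_increment_antimono:
  fixes f :: "real \<Rightarrow> real"
  assumes "concave_on {0..} f" "0 \<le> x" "x \<le> x'" "0 \<le> y"
  shows "f x + f (x' + y) \<le> f x' + f (x + y)"
proof (cases "x' + y = x")
  case False
  then have p: "x' + y - x > 0" using assms by auto
  define e where "e = y / (x' + y - x)"
  have l: "0 \<le> e" "e \<le> 1" using p assms by (auto simp: e_def field_simps)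
  have ly: "e * (x' + y - x) = y" using p by (simp add: e_def)
  have "e * f x + (1 - e) * f (x' + y) \<le> f (e * x + (1 - e) * (x' + y))"
    using assms l unfolding concave_on_iff by auto
  also have "e * x + (1 - e) * (x' + y) = x'" using ly by (simp add: algebra_simps)
  finally have 1: "e * f x + (1 - e) * f (x' + y) \<le> f x'" .
  have "(1 - e) * f x + e * f (x' + y) \<le> f ((1 - e) * x + e * (x' + y))"
    using assms l unfolding concave_on_iff by auto
  also have "(1 - e) * x + e * (x' + y) = x + y" using ly by (simp add: algebra_simps)
  finally have "(1 - e) * f x + e * f (x' + y) \<le> f (x + y)" .
  with 1 show ?thesis by (simp add: algebra_simps)
qed (use assms in auto)

text \<open>Gaps are indexed by their two ends instead of by their length, so that they become arcs.
  The fictitious period 0 stands for the last on-time before the model, hence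
  \<open>PDT\<close>.\<close>

definition offline_time :: "(nat \<Rightarrow> real) \<Rightarrow> real \<Rightarrow> nat \<Rightarrow> nat \<Rightarrow> real" where
  "offline_time L PDT a t = (\<Sum>i\<in>{a<..<t}. L i) + (if a = 0 then PDT else 0)"

text \<open>The period \<open>T + 1\<close> after the horizon is treated as a start that costs nothing.\<close>

definition start_cost ::
  "nat \<Rightarrow> (nat \<Rightarrow> real) \<Rightarrow> real \<Rightarrow> (real \<Rightarrow> real) \<Rightarrow> nat \<Rightarrow> nat \<Rightarrow> real" where
  "start_cost T L PDT CU a t = (if t \<le> T then CU (offline_time L PDT a t) else 0)"

lemma CUt_eq_start_cost:
  assumes "a < t" "t \<le> T"
  shows "CUt L PDT CU t (t - Suc a) = start_cost T L PDT CU a t"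
proof -
  have "(\<Sum>j=1..t - Suc a. L (t - j)) = (\<Sum>i\<in>{a<..<t}. L i)"
    using assms by (intro sum.reindex_bij_witness[of _ "\<lambda>i. t - i" "\<lambda>j. t - j"]) auto
  \<comment> \<open>The branch of \<open>OL\<close> that adds \<open>PDT\<close> is exactly the gap
    reaching back to 0.\<close>
  moreover have "t - Suc a < t - 1 \<longleftrightarrow> a \<noteq> 0" using assms by auto
  ultimately show ?thesis
    using assms by (auto simp: CUt_def OL_def start_cost_def offline_time_def)
qed

text \<open>The two branches of \<delta> merge because arcs ending at \<open>T + 1\<close> are
  free.\<close>

lemma \<delta>_eq_insertion_cost:
  assumes "l < t" "t + r \<le> T"
  shows "\<delta> T L PDT CU t l r = insertion_cost (start_cost T L PDT CU) t l r"
proof -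
  have 1: "CUt L PDT CU t l = start_cost T L PDT CU (t - Suc l) t"
    using CUt_eq_start_cost[of "t - Suc l" t T L PDT CU] assms by (simp add: Suc_diff_Suc)
  show ?thesis
  proof (cases "t + r < T")
    case True
    have "CUt L PDT CU (t + r + 1) r = start_cost T L PDT CU t (t + Suc r)"
      using CUt_eq_start_cost[of t "t + Suc r" T L PDT CU] True by simp
    moreover have "t + Suc r - Suc (t - Suc l) = l + r + 1" using assms by simp
    then have "CUt L PDT CU (t + r + 1) (l + r + 1)
        = start_cost T L PDT CU (t - Suc l) (t + Suc r)"
      using CUt_eq_start_cost[of "t - Suc l" "t + Suc r" T L PDT CU] True assms by (simp add: add_ac)
    ultimately show ?thesis using True 1 by (simp add: \<delta>_def insertion_cost_def)
  next
    case False
    then show ?thesis using 1 by (simp add: \<delta>_def insertion_cost_def start_cost_def)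
  qed
qed

lemma offline_time_split:
  assumes "a < t" "t < u"
  shows "offline_time L PDT a u = offline_time L PDT a t + (L t + offline_time L PDT t u)"
proof -
  have "{a<..<u} = {a<..<t} \<union> insert t {t<..<u}" using assms by auto
  then have "sum L {a<..<u} = sum L {a<..<t} + sum L (insert t {t<..<u})"
    by (simp only:) (intro sum.union_disjoint, auto)
  then show ?thesis using assms by (auto simp: offline_time_def)
qed

text \<open>The arc is widened one end at a time: first \<open>s\<close> moves to \<open>a\<close>,
  then \<open>w\<close> to \<open>u\<close>. Each move compares two increments of \<open>CU\<close>
  of equal length, and concavity makes the one starting later no larger. If the right end of the
  wider arc in a move is \<open>T + 1\<close>, its cost is 0 and monotonicity suffices.\<close>

lemma start_cost_insertion_mono:
  assumes L: "\<And>t. t \<in> {1..T} \<Longrightarrow> L t > 0" and PDT: "PDT \<ge> 0"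
    and CU: "mono_on {0..} CU" "concave_on {0..} CU"
    and ord: "a \<le> s" "s < t" "t < w" "w \<le> u" "u \<le> Suc T"
  defines "K \<equiv> start_cost T L PDT CU"
  shows "K s t + K t w - K s w \<le> K a t + K t u - K a u"
proof -
  let ?h = "offline_time L PDT"
  have h0: "0 \<le> ?h i j" if "j \<le> Suc T" for i j
    unfolding offline_time_def using that L PDT
    by (intro add_nonneg_nonneg sum_nonneg) (auto intro: less_imp_le)
  have hm1: "?h s t \<le> ?h a t"
    unfolding offline_time_def using ord L PDT
    by (intro add_mono sum_mono2) (auto intro: less_imp_le)
  have hm2: "?h t w \<le> ?h t u"
    unfolding offline_time_def using ord L PDT
    by (intro add_mono sum_mono2) (auto intro: less_imp_le)
  have Lt: "L t > 0" using L ord by auto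
  have s1: "K s t - K s w \<le> K a t - K a w"
  proof (cases "w \<le> T")
    case True
    then show ?thesis
      using concave_on_increment_antimono[OF CU(2) h0 hm1, of "L t + ?h t w"] h0[of w t] Lt ord
        offline_time_split[of s t w L PDT] offline_time_split[of a t w L PDT]
      by (simp add: K_def start_cost_def)
  next
    case False
    have "CU (?h s t) \<le> CU (?h a t)"
      using hm1 h0 ord by (intro mono_onD[OF CU(1)]) auto
    with False show ?thesis using ord by (simp add: K_def start_cost_def)
  qed
  have s2: "K t w - K a w \<le> K t u - K a u"
  proof (cases "u \<le> T")
    case True
    then show ?thesis
      using concave_on_increment_antimono[OF CU(2) h0 hm2, of "?h a t + L t"] h0[of t a] Lt ord
        offline_time_split[of a t u L PDT] offline_time_split[of a t w L PDT]
      by (simp add: K_def start_cost_def add_ac)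
  next
    case False
    have "CU (?h t w) \<le> CU (?h a w)"
      using h0[of w t] h0[of t a] Lt ord offline_time_split[of a t w L PDT]
      by (intro mono_onD[OF CU(1)]) auto
    with False show ?thesis by (simp add: K_def start_cost_def)
  qed
  show ?thesis using s1 s2 by linarith
qed

section \<open>The binary cost as a path length\<close>

lemma last_filter_upt:
  fixes p :: "nat \<Rightarrow> bool"
  assumes "a < n"
  defines "s \<equiv> last (a # filter p [Suc a..<n])"
  shows "a \<le> s" "s < n" "s = a \<or> p s" "\<And>j. \<lbrakk>s < j; j < n\<rbrakk> \<Longrightarrow> \<not> p j"
proof -
  let ?P = "\<lambda>s n. a \<le> s \<and> s < n \<and> (s = a \<or> p s) \<and> (\<forall>j. s < j \<and> j < n \<longrightarrow> \<not> p j)"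
  have "?P (last (a # filter p [Suc a..<n])) n"
    using assms(1)
  proof (induction n)
    case (Suc n)
    show ?case
    proof (cases "a = n")
      case False
      then have IH: "?P (last (a # filter p [Suc a..<n])) n"
        by (intro Suc.IH) (use Suc.prems in linarith)
      have "filter p [Suc a..<Suc n] = filter p [Suc a..<n] @ (if p n then [n] else [])"
        using False Suc.prems by simp
      then have "last (a # filter p [Suc a..<Suc n]) =
          (if p n then n else last (a # filter p [Suc a..<n]))" by (simp del: upt_Suc)
      moreover define l where "l = last (a # filter p [Suc a..<n])"
      ultimately have last: "last (a # filter p [Suc a..<Suc n]) = (if p n then n else l)" by simp
      have "?P (if p n then n else l) (Suc n)"
        using IH[folded l_def] Suc.prems by (cases "p n"; simp) (metis less_SucE)
      then show ?thesis unfolding last .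
    qed auto
  qed simp
  then show "a \<le> s" "s < n" "s = a \<or> p s" "\<And>j. \<lbrakk>s < j; j < n\<rbrakk> \<Longrightarrow> \<not> p j"
    unfolding s_def by blast+
qed

text \<open>All periods strictly between the preceding path node and \<open>t\<close> are off. The
  run cannot be longer, since that node is either on or the start 0, which the bound
  \<open>t - 1\<close> excludes.\<close>

lemma ol_eq:
  assumes "0 < t" and v: "\<And>i. v $ i \<in> {0, 1}"
  shows "ol per t v = t - Suc (last (0 # filter (\<lambda>t. v $ per t = 1) [Suc 0..<t]))"
proof -
  define s where "s = last (0 # filter (\<lambda>t. v $ per t = 1) [Suc 0..<t])"
  note s = last_filter_upt[OF assms(1), of "\<lambda>t. v $ per t = 1", folded s_def]
  have "ol per t v = t - Suc s"
    unfolding ol_def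
  proof (rule Max_eqI)
    have "v $ per (t - j) = 0" if "1 \<le> j" "j \<le> t - Suc s" for j
      using s(4)[of "t - j"] v[of "per (t - j)"] that s(2) by auto
    then show "t - Suc s \<in> {l \<in> {0..t - 1}. \<forall>j\<in>{1..l}. v $ per (t - j) = 0}" by auto
  next
    fix l assume l: "l \<in> {l \<in> {0..t - 1}. \<forall>j\<in>{1..l}. v $ per (t - j) = 0}"
    show "l \<le> t - Suc s"
    proof (rule ccontr)
      assume "\<not> l \<le> t - Suc s"
      then have "t - s \<in> {1..l}" "s \<noteq> 0" using s(2) l by auto
      then have "v $ per (t - (t - s)) = 0" using l by blast
      then show False using s(2,3) \<open>s \<noteq> 0\<close> by simp
    qed
  qed auto
  then show ?thesis by (simp add: s_def)
qed

lemma DCU_eq_path_sum: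
  assumes v: "v \<in> binary_cube"
  shows "DCU T L PDT CU per v =
    path_sum (start_cost T L PDT CU) (on_path (\<lambda>t. v $ per t = 1) 0 (Suc T))"
proof -
  let ?p = "\<lambda>t. v $ per t = 1" and ?K = "start_cost T L PDT CU"
  have bin: "v $ i \<in> {0, 1}" for i using v by (simp add: binary_cube_def)
  have snoc: "path_sum ?K (0 # filter ?p [Suc 0..<n] @ [m]) =
      path_sum ?K (0 # filter ?p [Suc 0..<n]) + ?K (last (0 # filter ?p [Suc 0..<n])) m" for n m
    using path_sum_snoc[of "0 # filter ?p [Suc 0..<n]" ?K m] by simp
  \<comment> \<open>Induction over path prefixes without an end node: an on-period appends one arc,
    whose cost is its start-up cost, and an off-period appends nothing.\<close>
  have "path_sum ?K (0 # filter ?p [Suc 0..<Suc n]) = (\<Sum>t=1..n. DCUt L PDT CU per t v)"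
    if "n \<le> T" for n
    using that
  proof (induction n)
    case (Suc n)
    let ?s = "last (0 # filter ?p [Suc 0..<Suc n])"
    have "?s < Suc n" by (rule last_filter_upt) simp
    then have "CUt L PDT CU (Suc n) (Suc n - Suc ?s) = ?K ?s (Suc n)"
      using Suc.prems by (intro CUt_eq_start_cost)
    moreover have "ol per (Suc n) v = Suc n - Suc ?s" by (rule ol_eq[OF _ bin]) simp
    ultimately have "DCUt L PDT CU per (Suc n) v = (if ?p (Suc n) then ?K ?s (Suc n) else 0)"
      by (simp only: DCUt_def)
    moreover have "filter ?p [Suc 0..<Suc (Suc n)] =
        filter ?p [Suc 0..<Suc n] @ (if ?p (Suc n) then [Suc n] else [])"
      by (subst upt_Suc) simp
    ultimately show ?case
      using Suc snoc[of "Suc n" "Suc n"] by (auto simp del: upt_Suc)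
  qed simp
  \<comment> \<open>The arc closing the path at \<open>T + 1\<close> costs nothing.\<close>
  from this[of T] show ?thesis
    unfolding DCU_def snoc by (simp add: start_cost_def del: upt_Suc)
qed

section \<open>The convex hull of the epigraph\<close>

lemma epigraph_LCU:
  "epigraph unit_cube (LCU T L PDT CU per) =
    convex hull (epigraph binary_cube (DCU T L PDT CU per))"
  unfolding LCU_def using theI'[OF LCU_ex1] by blast

lemma sum_\<delta>_eq_tree_sum:
  assumes "B \<in> rank_labeled_trees T"
  shows "(\<Sum>t\<in>{1..T}. \<delta> T L PDT CU t (left_count B t) (right_count B t) * x t) =
    tree_sum (\<lambda>t l r. insertion_cost (start_cost T L PDT CU) t l r * x t) B"
proof -
  have B: "inorder B = [Suc 0..<Suc T]" using assms by (simp add: rank_labeled_trees_def)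
  then have "set_tree B = set [Suc 0..<Suc T]" by (metis set_inorder)
  then have st: "set_tree B = {1..T}" by auto
  have "distinct (inorder B)" unfolding B by (rule distinct_upt)
  from sum_counts_eq_tree_sum[OF this, of "\<lambda>t l r. \<delta> T L PDT CU t l r * x t"]
  have "(\<Sum>t\<in>{1..T}. \<delta> T L PDT CU t (left_count B t) (right_count B t) * x t) =
    tree_sum (\<lambda>t l r. \<delta> T L PDT CU t l r * x t) B" by (simp only: st)
  \<comment> \<open>Generalised to subtrees labelled by intervals, which supply the size bounds that
    \<open>\<delta>_eq_insertion_cost\<close> requires at each node.\<close>
  also have "tree_sum (\<lambda>t l r. \<delta> T L PDT CU t l r * x t) C =
      tree_sum (\<lambda>t l r. insertion_cost (start_cost T L PDT CU) t l r * x t) C"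
    if "inorder C = [Suc a..<u]" "u \<le> Suc T" for C a u
    using that
  proof (induction C arbitrary: a u)
    case (Node l t r)
    note t = inorder_upt_NodeD[OF Node.prems(1)]
    have "t + size r \<le> T" using t(6) Node.prems(2) by simp
    with Node.IH(1)[OF t(3)] Node.IH(2)[OF t(4)] t Node.prems(2) show ?case
      by (simp add: \<delta>_eq_insertion_cost)
  qed simp
  from this[OF B] have "tree_sum (\<lambda>t l r. \<delta> T L PDT CU t l r * x t) B =
      tree_sum (\<lambda>t l r. insertion_cost (start_cost T L PDT CU) t l r * x t) B" by simp
  finally show ?thesis .
qed

theorem theorem6p6:
  fixes T :: nat
    and L :: "nat \<Rightarrow> real"
    and PDT :: real
    and CU :: "real \<Rightarrow> real"
    and per :: "nat \<Rightarrow> 'n::finite"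
  assumes "T \<ge> 1"
    and "bij_betw per {1..T} UNIV"
    and "\<And>t. t \<in> {1..T} \<Longrightarrow> L t > 0"
    and "PDT \<ge> 0"
    and "\<And>x. x \<ge> 0 \<Longrightarrow> CU x \<ge> 0"
    and "mono_on {0..} CU"
    and "concave_on {0..} CU"
    and "CU 0 = 0"
  shows "epigraph unit_cube (LCU T L PDT CU per) =
    {(v, c).
       (\<forall>B \<in> rank_labeled_trees T.
          c \<ge> (\<Sum>t\<in>{1..T}. \<delta> T L PDT CU t (left_count B t) (right_count B t) * v $ per t)) \<and>
       (\<forall>t\<in>{1..T}. 0 \<le> v $ per t \<and> v $ per t \<le> 1)}"
proof -
  define D where "D B v =
    (\<Sum>t\<in>{1..T}. \<delta> T L PDT CU t (left_count B t) (right_count B t) * v $ per t)"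
    for B and v :: "real ^ 'n"
  define K where "K = start_cost T L PDT CU"
  let ?R = "{(v, c). (\<forall>B \<in> rank_labeled_trees T. D B v \<le> c) \<and> v \<in> unit_cube}"
  let ?H = "convex hull (epigraph binary_cube (DCU T L PDT CU per))"
  have cube: "v \<in> unit_cube \<longleftrightarrow> (\<forall>t\<in>{1..T}. 0 \<le> v $ per t \<and> v $ per t \<le> 1)" for v :: "real ^ 'n"
    using bij_betw_imp_surj_on[OF assms(2)]
    by (auto simp: unit_cube_def) (metis UNIV_I imageE)+
  have D_lin: "D B (p *\<^sub>R v + q *\<^sub>R w) = p * D B v + q * D B w" for B p q v w
    by (simp add: D_def sum_distrib_left sum.distrib algebra_simps)
  have D_tree: "D B v = tree_sum (\<lambda>t l r. insertion_cost K t l r * v $ per t) B"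
    if "B \<in> rank_labeled_trees T" for B v
    unfolding D_def K_def by (rule sum_\<delta>_eq_tree_sum[OF that])
  \<comment> \<open>For the full horizon, the additive term \<open>K 0 (Suc T)\<close> in the
    comparison of trees and paths disappears.\<close>
  have K_end: "K a (Suc T) = 0" for a by (simp add: K_def start_cost_def)
  have "?H \<subseteq> ?R"
  proof (rule hull_minimal)
    show "epigraph binary_cube (DCU T L PDT CU per) \<subseteq> ?R"
    proof clarify
      fix v :: "real ^ 'n" and c assume "(v, c) \<in> epigraph binary_cube (DCU T L PDT CU per)"
      then have v: "v \<in> binary_cube" and c: "DCU T L PDT CU per v \<le> c"
        by (auto simp: epigraph_def)
      have bin: "v $ per t \<in> {0, 1}" for t using v by (simp add: binary_cube_def)
      have "D B v \<le> c" if B: "B \<in> rank_labeled_trees T" for B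
      proof -
        have "tree_sum (\<lambda>t l r. insertion_cost K t l r * v $ per t) B + K 0 (Suc T)
          \<le> path_sum K (on_path (\<lambda>t. v $ per t = 1) 0 (Suc T))"
        proof (rule tree_sum_le_path_sum)
          show "K s t + K t w - K s w \<le> K a t + K t u - K a u"
            if "a \<le> s" "s < t" "t < w" "w \<le> u" "u \<le> Suc T" for a s t w u
            unfolding K_def by (rule start_cost_insertion_mono[OF assms(3,4,6,7) that])
          show "inorder B = [Suc 0..<Suc T]" using B by (simp add: rank_labeled_trees_def)
        qed (use bin in auto)
        then show ?thesis
          using c DCU_eq_path_sum[OF v, of T L PDT CU per, folded K_def] D_tree[OF B, of v]
          by (simp add: K_end del: upt_Suc)
      qed
      moreover have "v \<in> unit_cube"
        unfolding unit_cube_eq_hull by (rule hull_inc[OF v])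
      ultimately show "(\<forall>B \<in> rank_labeled_trees T. D B v \<le> c) \<and> v \<in> unit_cube" by blast
    qed
    show "convex ?R"
    proof (intro convexI)
      fix x y :: "(real ^ 'n) \<times> real" and p q :: real
      assume x: "x \<in> ?R" and y: "y \<in> ?R" and pq: "0 \<le> p" "0 \<le> q" "p + q = 1"
      have "convex (unit_cube :: (real ^ 'n) set)"
        unfolding unit_cube_eq_hull by (rule convex_convex_hull)
      then have "p *\<^sub>R fst x + q *\<^sub>R fst y \<in> unit_cube"
        using x y pq by (auto intro: convexD)
      moreover have "D B (p *\<^sub>R fst x + q *\<^sub>R fst y) \<le> p * snd x + q * snd y"
        if "B \<in> rank_labeled_trees T" for B
        unfolding D_lin using x y pq that by (auto intro!: add_mono mult_left_mono)
      ultimately show "p *\<^sub>R x + q *\<^sub>R y \<in> ?R" by (auto simp: case_prod_unfold)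
    qed
  qed
  moreover have "?R \<subseteq> ?H"
  proof clarify
    fix v :: "real ^ 'n" and c
    assume le: "\<forall>B \<in> rank_labeled_trees T. D B v \<le> c" and v: "v \<in> unit_cube"
    \<comment> \<open>A single tree, chosen from \<open>v\<close>, is tight at all thresholds
      simultaneously.\<close>
    obtain B where B: "inorder B = [Suc 0..<Suc T]" and eq: "\<And>\<theta>.
      tree_sum (\<lambda>t l r. insertion_cost K t l r * of_bool (\<theta> \<le> v $ per t)) B + K 0 (Suc T)
        = path_sum K (on_path (\<lambda>t. \<theta> \<le> v $ per t) 0 (Suc T))"
      using exists_tree_sum_eq_path_sum[of 0 "Suc T" K "\<lambda>t. v $ per t"] by blast
    have BT: "B \<in> rank_labeled_trees T" using B by (simp add: rank_labeled_trees_def)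
    \<comment> \<open>The graph of the linear form \<open>D B\<close> is raised by the constant
      slack \<open>c - D B v\<close>, so that it passes through \<open>(v, c)\<close>. Linearity
      makes \<open>G\<close> convex. It contains the threshold vectors because \<open>D B\<close>
      equals the binary cost there and the slack is nonnegative; hence it contains
      \<open>v\<close>.\<close>
    define G where "G = {w. (w, D B w + (c - D B v)) \<in> ?H}"
    have "convex G"
    proof (intro convexI)
      fix x y :: "real ^ 'n" and p q :: real
      assume x: "x \<in> G" and y: "y \<in> G" and pq: "0 \<le> p" "0 \<le> q" "p + q = 1"
      have "p *\<^sub>R (x, D B x + (c - D B v)) + q *\<^sub>R (y, D B y + (c - D B v)) \<in> ?H"
        using x y pq by (intro convexD[OF convex_convex_hull]) (auto simp: G_def)
      also have "p *\<^sub>R (x, D B x + (c - D B v)) + q *\<^sub>R (y, D B y + (c - D B v)) =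
        (p *\<^sub>R x + q *\<^sub>R y, D B (p *\<^sub>R x + q *\<^sub>R y) + (p + q) * (c - D B v))"
        by (simp add: D_lin algebra_simps)
      finally show "p *\<^sub>R x + q *\<^sub>R y \<in> G" by (simp add: G_def pq)
    qed
    moreover have "range (\<lambda>\<theta>. \<chi> i. of_bool (\<theta> \<le> v $ i)) \<subseteq> G"
    proof clarify
      fix \<theta> :: real
      let ?w = "(\<chi> i. of_bool (\<theta> \<le> v $ i)) :: real ^ 'n"
      have w: "?w \<in> binary_cube" by (simp add: binary_cube_def)
      have "D B ?w = DCU T L PDT CU per ?w"
        using eq[of \<theta>] D_tree[OF BT, of ?w] DCU_eq_path_sum[OF w, of T L PDT CU per, folded K_def]
        by (simp add: K_end del: upt_Suc)
      then have "(?w, D B ?w + (c - D B v)) \<in> epigraph binary_cube (DCU T L PDT CU per)"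
        using w le BT by (simp add: epigraph_def)
      then show "?w \<in> G" unfolding G_def by (simp add: hull_inc)
    qed
    ultimately have "v \<in> G" using in_convex_hull_thresholds[OF v] hull_minimal by blast
    then show "(v, c) \<in> ?H" by (simp add: G_def)
  qed
  ultimately have "?H = ?R" by blast
  then show ?thesis unfolding epigraph_LCU cube D_def by simp
qed

end
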